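(* Let $k\ge2$ be an integer and let $\gamma:I\to S^n\subset\mathbb R^{n+1}$ be a smooth curve defined on an interval $I\subset\mathbb R$, parametrized by arc length. Then $\gamma$ is a $k$-harmonic curve if and only if $$(\nabla_{\gamma'}\nabla_{\gamma'})^{k-1}(\nabla_{\gamma'}\gamma')+(\nabla_{\gamma'}\nabla_{\gamma'})^{k-2}(\nabla_{\gamma'}\gamma')-g\big((\nabla_{\gamma'}\nabla_{\gamma'})^{k-2}(\nabla_{\gamma'}\gamma'),\gamma'\big)\gamma'=0 .$$
   Context: $S^n$ is the unit sphere with its standard metric $g$ of constant sectional curvature $1$; $\nabla$ is its Levi-Civita connection and $\nabla_{\gamma'}$ the covariant derivative along $\gamma$; $\gamma'$ is the derivative with respect to arc length. For a smooth map $\phi:(M,g_M)\to(N,h)$, let $\{e_i\}$ be a local orthonormal frame on $M$, $\overline\nabla$ the induced connection on $\phi^{-1}TN$, $\tau(\phi)=\sum_i\big(\overline\nabla_{e_i}d\phi(e_i)-d\phi(\nabla^M_{e_i}e_i)\big)$ the tension field, $\overline\Delta=-\sum_i(\overline\nabla_{e_i}\overline\nabla_{e_i}-\overline\nabla_{\nabla^M_{e_i}e_i})$ the rough Laplacian, with iterates $\overline\Delta^{j}$ ($\overline\Delta^0=\mathrm{id}$), and $\mathscr R(V)=\sum_iR^N(V,d\phi(e_i))d\phi(e_i)$ with $R^N(X,Y)=\nabla^N_X\nabla^N_Y-\nabla^N_Y\nabla^N_X-\nabla^N_{[X,Y]}$. For $k\ge2$, $\phi$ is $k$-harmonic if $\tau_k(\phi):=\overline\Delta\big(\overline\Delta^{k-2}\tau(\phi)\big)-\mathscr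 R\big(\overline\Delta^{k-2}\tau(\phi)\big)=0$. A curve is $k$-harmonic if it is so as a map from $I$ with the standard Euclidean metric. *)

theory Defs
  imports "HOL-Analysis.Analysis"
begin

section \<open>Smooth maps on subsets of Euclidean spaces\<close>

primrec Ck_on :: "nat \<Rightarrow> 'a::euclidean_space set \<Rightarrow> ('a \<Rightarrow> 'b::real_normed_vector) \<Rightarrow> bool" where
  "Ck_on 0 U f \<longleftrightarrow> continuous_on U f"
| "Ck_on (Suc k) U f \<longleftrightarrow>
     f differentiable_on U \<and> (\<forall>v. Ck_on k U (\<lambda>x. frechet_derivative f (at x) v))"

text \<open>
  A map on an arbitrary subset \<open>A\<close> is smooth if it has local \<open>C\<^sup>\<infinity>\<close> extensions to open sets.
  This is used both for the sphere (as a submanifold) and for intervals, possibly with end points.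
\<close>
definition smooth_on :: "'a::euclidean_space set \<Rightarrow> ('a \<Rightarrow> 'b::real_normed_vector) \<Rightarrow> bool" where
  "smooth_on A f \<longleftrightarrow>
     (\<forall>p\<in>A. \<exists>U g. open U \<and> p \<in> U \<and> (\<forall>k. Ck_on k U g) \<and> (\<forall>x\<in>A \<inter> U. g x = f x))"


section \<open>The round unit sphere\<close>

text \<open>
  The sphere is \<open>sphere 0 1\<close> in a Euclidean space of dimension \<open>n + 1\<close>; tangent vectors are vectors
  of the ambient space and the metric is the restriction of the ambient inner product. Functions
  and vector fields on the sphere are total functions on the ambient space of which only the values
  on the sphere are relevant.
\<close>

abbreviation unit_sphere :: "'a::euclidean_space set" where
  "unit_sphere \<equiv> sphere 0 1"

definition tangent :: "'a::euclidean_space \<Rightarrow> 'a set" where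
  "tangent p = {v. p \<bullet> v = 0}"

definition vfield :: "('a::euclidean_space \<Rightarrow> 'a) \<Rightarrow> bool" where
  "vfield X \<longleftrightarrow> smooth_on unit_sphere X \<and> (\<forall>p\<in>unit_sphere. X p \<in> tangent p)"

text \<open>
  \<open>sderiv f p v\<close> is the derivative at \<open>p\<close> in the tangent direction \<open>v\<close> of a map \<open>f\<close> on the sphere.
  Composing with the retraction \<open>sgn x = x /\<^sub>R norm x\<close> makes it depend only on \<open>f\<close> on the sphere.
\<close>
definition sderiv :: "('a::euclidean_space \<Rightarrow> 'b::real_normed_vector) \<Rightarrow> 'a \<Rightarrow> 'a \<Rightarrow> 'b" where
  "sderiv f p v = frechet_derivative (\<lambda>x. f (sgn x)) (at p) v"

definition lie_bracket :: "('a::euclidean_space \<Rightarrow> 'a) \<Rightarrow> ('a \<Rightarrow> 'a) \<Rightarrow> 'a \<Rightarrow> 'a" where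
  "lie_bracket X Y p = sderiv Y p (X p) - sderiv X p (Y p)"

text \<open>\<open>nab p v Y\<close> is the covariant derivative at \<open>p\<close> of the vector field \<open>Y\<close> in direction \<open>v\<close>.\<close>

locale connection =
  fixes nab :: "'a::euclidean_space \<Rightarrow> 'a \<Rightarrow> ('a \<Rightarrow> 'a) \<Rightarrow> 'a"
  assumes nab_vfield: "vfield X \<Longrightarrow> vfield Y \<Longrightarrow> vfield (\<lambda>p. nab p (X p) Y)"
    and nab_cong: "vfield Y \<Longrightarrow> vfield Z \<Longrightarrow> (\<And>q. q \<in> unit_sphere \<Longrightarrow> Y q = Z q) \<Longrightarrow>
      p \<in> unit_sphere \<Longrightarrow> v \<in> tangent p \<Longrightarrow> nab p v Y = nab p v Z"
    and nab_linear: "vfield Y \<Longrightarrow> p \<in> unit_sphere \<Longrightarrow> u \<in> tangent p \<Longrightarrow> v \<in> tangent p \<Longrightarrow>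
      nab p (a *\<^sub>R u + b *\<^sub>R v) Y = a *\<^sub>R nab p u Y + b *\<^sub>R nab p v Y"
    and nab_add: "vfield Y \<Longrightarrow> vfield Z \<Longrightarrow> p \<in> unit_sphere \<Longrightarrow> v \<in> tangent p \<Longrightarrow>
      nab p v (\<lambda>q. Y q + Z q) = nab p v Y + nab p v Z"
    and nab_leibniz: "smooth_on unit_sphere f \<Longrightarrow> vfield Y \<Longrightarrow> p \<in> unit_sphere \<Longrightarrow>
      v \<in> tangent p \<Longrightarrow> nab p v (\<lambda>q. f q *\<^sub>R Y q) = sderiv f p v *\<^sub>R Y p + f p *\<^sub>R nab p v Y"

locale levi_civita = connection nab for nab :: "'a::euclidean_space \<Rightarrow> 'a \<Rightarrow> ('a \<Rightarrow> 'a) \<Rightarrow> 'a" +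
  assumes torsion_free: "vfield X \<Longrightarrow> vfield Y \<Longrightarrow> p \<in> unit_sphere \<Longrightarrow>
      nab p (X p) Y - nab p (Y p) X = lie_bracket X Y p"
    and metric: "vfield Y \<Longrightarrow> vfield Z \<Longrightarrow> p \<in> unit_sphere \<Longrightarrow> v \<in> tangent p \<Longrightarrow>
      sderiv (\<lambda>q. Y q \<bullet> Z q) p v = nab p v Y \<bullet> Z p + Y p \<bullet> nab p v Z"

definition curvature_field ::
  "('a::euclidean_space \<Rightarrow> 'a \<Rightarrow> ('a \<Rightarrow> 'a) \<Rightarrow> 'a) \<Rightarrow> ('a \<Rightarrow> 'a) \<Rightarrow> ('a \<Rightarrow> 'a) \<Rightarrow> ('a \<Rightarrow> 'a) \<Rightarrow> 'a \<Rightarrow> 'a"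
  where
  "curvature_field nab X Y Z p =
     nab p (X p) (\<lambda>q. nab q (Y q) Z) - nab p (Y p) (\<lambda>q. nab q (X q) Z)
     - nab p (lie_bracket X Y p) Z"

text \<open>
  The curvature tensor \<open>R(u, v) w\<close> at \<open>p\<close>; by tensoriality the value is the same for all
  vector fields extending the tangent vectors \<open>u\<close>, \<open>v\<close>, \<open>w\<close>.
\<close>
definition curvature ::
  "('a::euclidean_space \<Rightarrow> 'a \<Rightarrow> ('a \<Rightarrow> 'a) \<Rightarrow> 'a) \<Rightarrow> 'a \<Rightarrow> 'a \<Rightarrow> 'a \<Rightarrow> 'a \<Rightarrow> 'a" where
  "curvature nab p u v w =
     (THE r. \<exists>X Y Z. vfield X \<and> vfield Y \<and> vfield Z \<and> X p = u \<and> Y p = v \<and> Z p = w \<and>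
        r = curvature_field nab X Y Z p)"


section \<open>Curves in the sphere\<close>

abbreviation velocity :: "real set \<Rightarrow> (real \<Rightarrow> 'a::euclidean_space) \<Rightarrow> real \<Rightarrow> 'a" where
  "velocity I \<gamma> t \<equiv> vector_derivative \<gamma> (at t within I)"

definition field_along :: "real set \<Rightarrow> (real \<Rightarrow> 'a::euclidean_space) \<Rightarrow> (real \<Rightarrow> 'a) \<Rightarrow> bool" where
  "field_along I \<gamma> V \<longleftrightarrow> smooth_on I V \<and> (\<forall>t\<in>I. V t \<in> tangent (\<gamma> t))"

text \<open>
  The connection induced by \<open>nab\<close> on the pullback of the tangent bundle along \<open>\<gamma>\<close>:
  \<open>nb t c V\<close> is the derivative at \<open>t\<close> of the field \<open>V\<close> along \<open>\<gamma>\<close> in the direction of the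
  tangent vector \<open>c\<close> of the interval. It is characterised among the connections
  on this bundle by its value on fields of the form \<open>Y \<circ> \<gamma>\<close>.
\<close>
locale induced_connection =
  fixes nab :: "'a::euclidean_space \<Rightarrow> 'a \<Rightarrow> ('a \<Rightarrow> 'a) \<Rightarrow> 'a"
    and I :: "real set"
    and \<gamma> :: "real \<Rightarrow> 'a"
    and nb :: "real \<Rightarrow> real \<Rightarrow> (real \<Rightarrow> 'a) \<Rightarrow> 'a"
  assumes nb_field: "smooth_on I X \<Longrightarrow> field_along I \<gamma> V \<Longrightarrow> field_along I \<gamma> (\<lambda>t. nb t (X t) V)"
    and nb_cong: "field_along I \<gamma> V \<Longrightarrow> field_along I \<gamma> W \<Longrightarrow> (\<And>s. s \<in> I \<Longrightarrow> V s = W s) \<Longrightarrow>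
      t \<in> I \<Longrightarrow> nb t c V = nb t c W"
    and nb_linear: "field_along I \<gamma> V \<Longrightarrow> t \<in> I \<Longrightarrow>
      nb t (a * c + b * d) V = a *\<^sub>R nb t c V + b *\<^sub>R nb t d V"
    and nb_add: "field_along I \<gamma> V \<Longrightarrow> field_along I \<gamma> W \<Longrightarrow> t \<in> I \<Longrightarrow>
      nb t c (\<lambda>s. V s + W s) = nb t c V + nb t c W"
    and nb_leibniz: "smooth_on I f \<Longrightarrow> field_along I \<gamma> V \<Longrightarrow> t \<in> I \<Longrightarrow>
      nb t c (\<lambda>s. f s *\<^sub>R V s) = (c * vector_derivative f (at t within I)) *\<^sub>R V t + f t *\<^sub>R nb t c V"
    and nb_pullback: "vfield Y \<Longrightarrow> t \<in> I \<Longrightarrow>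
      nb t c (\<lambda>s. Y (\<gamma> s)) = nab (\<gamma> t) (c *\<^sub>R velocity I \<gamma> t) Y"

text \<open>
  The domain is an interval with the Euclidean metric, with the global orthonormal frame consisting
  of the coordinate field \<open>e1\<close>, so that the sums over a frame have a single term.
\<close>

definition e1 :: "real \<Rightarrow> real" where
  "e1 t = 1"

definition nabla_euclid :: "real set \<Rightarrow> (real \<Rightarrow> real) \<Rightarrow> (real \<Rightarrow> real) \<Rightarrow> real \<Rightarrow> real" where
  "nabla_euclid I X Y t = X t * vector_derivative Y (at t within I)"

definition differential ::
  "real set \<Rightarrow> (real \<Rightarrow> 'a::euclidean_space) \<Rightarrow> (real \<Rightarrow> real) \<Rightarrow> real \<Rightarrow> 'a" where
  "differential I \<gamma> X t = X t *\<^sub>R velocity I \<gamma> t"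

definition tension ::
  "real set \<Rightarrow> (real \<Rightarrow> 'a::euclidean_space) \<Rightarrow> (real \<Rightarrow> real \<Rightarrow> (real \<Rightarrow> 'a) \<Rightarrow> 'a) \<Rightarrow> real \<Rightarrow> 'a" where
  "tension I \<gamma> nb t =
     nb t (e1 t) (differential I \<gamma> e1) - differential I \<gamma> (nabla_euclid I e1 e1) t"

definition rough_laplacian ::
  "real set \<Rightarrow> (real \<Rightarrow> real \<Rightarrow> (real \<Rightarrow> 'a) \<Rightarrow> 'a) \<Rightarrow> (real \<Rightarrow> 'a) \<Rightarrow> real \<Rightarrow> 'a::euclidean_space" where
  "rough_laplacian I nb V t =
     - (nb t (e1 t) (\<lambda>s. nb s (e1 s) V) - nb t (nabla_euclid I e1 e1 t) V)"

definition curvature_term ::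
  "('a::euclidean_space \<Rightarrow> 'a \<Rightarrow> ('a \<Rightarrow> 'a) \<Rightarrow> 'a) \<Rightarrow> real set \<Rightarrow> (real \<Rightarrow> 'a) \<Rightarrow> (real \<Rightarrow> 'a) \<Rightarrow> real \<Rightarrow> 'a"
  where
  "curvature_term nab I \<gamma> V t =
     curvature nab (\<gamma> t) (V t) (differential I \<gamma> e1 t) (differential I \<gamma> e1 t)"

definition k_tension ::
  "('a::euclidean_space \<Rightarrow> 'a \<Rightarrow> ('a \<Rightarrow> 'a) \<Rightarrow> 'a) \<Rightarrow> real set \<Rightarrow> (real \<Rightarrow> 'a) \<Rightarrow>
   (real \<Rightarrow> real \<Rightarrow> (real \<Rightarrow> 'a) \<Rightarrow> 'a) \<Rightarrow> nat \<Rightarrow> real \<Rightarrow> 'a" where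
  "k_tension nab I \<gamma> nb k t =
     rough_laplacian I nb ((rough_laplacian I nb ^^ (k - 2)) (tension I \<gamma> nb)) t
     - curvature_term nab I \<gamma> ((rough_laplacian I nb ^^ (k - 2)) (tension I \<gamma> nb)) t"

definition k_harmonic_curve ::
  "('a::euclidean_space \<Rightarrow> 'a \<Rightarrow> ('a \<Rightarrow> 'a) \<Rightarrow> 'a) \<Rightarrow> real set \<Rightarrow> (real \<Rightarrow> 'a) \<Rightarrow>
   (real \<Rightarrow> real \<Rightarrow> (real \<Rightarrow> 'a) \<Rightarrow> 'a) \<Rightarrow> nat \<Rightarrow> bool" where
  "k_harmonic_curve nab I \<gamma> nb k \<longleftrightarrow> (\<forall>t\<in>I. k_tension nab I \<gamma> nb k t = 0)"

text \<open>\<open>\<nabla>\<^sub>\<gamma>\<^sub>'\<close>, the covariant derivative along \<open>\<gamma>\<close>.\<close>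
definition cov_deriv ::
  "(real \<Rightarrow> real \<Rightarrow> (real \<Rightarrow> 'a) \<Rightarrow> 'a) \<Rightarrow> (real \<Rightarrow> 'a) \<Rightarrow> real \<Rightarrow> 'a::euclidean_space" where
  "cov_deriv nb V t = nb t 1 V"


section \<open>The assumptions are satisfiable\<close>

text \<open>
  The orthogonal projection of the ambient derivative is a Levi-Civita connection of the sphere, and
  its pullback along any smooth curve exists.
\<close>

lemma Ck_on_mono: "Ck_on (Suc k) U f \<Longrightarrow> Ck_on k U f"
  by (induction k arbitrary: f) (auto intro: differentiable_imp_continuous_on)

lemma Ck_on_cong:
  assumes "open U" "\<And>x. x \<in> U \<Longrightarrow> f x = g x" "Ck_on k U f"
  shows "Ck_on k U g"
  using assms(2,3)
proof (induction k arbitrary: f g)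
  case 0
  then show ?case using continuous_on_cong[of U U f g] by simp
next
  case (Suc k)
  have d: "f differentiable (at x)" if "x \<in> U" for x
    using Suc.prems(2) that assms(1) by (simp add: differentiable_on_eq_differentiable_at)
  have fd: "frechet_derivative f (at x) = frechet_derivative g (at x)" if "x \<in> U" for x
    using frechet_derivative_transform_within_open[OF d[OF that] assms(1) that] Suc.prems(1) by blast
  have "g differentiable_on U"
    using Suc.prems unfolding differentiable_on_def
    by (metis Ck_on.simps(2) differentiable_on_def differentiable_transform_within zero_less_one)
  moreover have "Ck_on k U (\<lambda>x. frechet_derivative g (at x) v)" for v
    by (rule Suc.IH[of "\<lambda>x. frechet_derivative f (at x) v"]) (use fd Suc.prems(2) in auto)
  ultimately show ?case by simp
qed

lemma Ck_on_subset: "open U \<Longrightarrow> open V \<Longrightarrow> V \<subseteq> U \<Longrightarrow> Ck_on k U f \<Longrightarrow> Ck_on k V f"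
  by (induction k arbitrary: f) (auto intro: continuous_on_subset differentiable_on_subset)

lemma Ck_on_const: "open U \<Longrightarrow> Ck_on k U (\<lambda>x. c)"
  by (induction k arbitrary: c) (auto simp: frechet_derivative_const)

lemma Ck_on_deriv:
  assumes "open U" "\<And>x. x \<in> U \<Longrightarrow> (f has_derivative f' x) (at x)" "\<And>v. Ck_on k U (\<lambda>x. f' x v)"
  shows "Ck_on (Suc k) U f"
proof -
  have fd: "frechet_derivative f (at x) = f' x" if "x \<in> U" for x
    using assms(2)[OF that] frechet_derivative_at by metis
  have "f differentiable_on U"
    using assms(1,2) by (auto simp: differentiable_on_eq_differentiable_at differentiable_def)
  moreover have "Ck_on k U (\<lambda>x. frechet_derivative f (at x) v)" for v
    by (rule Ck_on_cong[OF assms(1) _ assms(3)[of v]]) (simp add: fd)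
  ultimately show ?thesis by simp
qed

lemma Ck_on_ident: "open U \<Longrightarrow> Ck_on k U (\<lambda>x. x)"
proof (cases k)
  case (Suc m)
  assume "open U"
  then show ?thesis unfolding Suc
    by (intro Ck_on_deriv[where f' = "\<lambda>_ v. v"]) (auto simp: Ck_on_const)
qed simp

lemma Ck_on_works:
  "open U \<Longrightarrow> Ck_on (Suc k) U f \<Longrightarrow> x \<in> U \<Longrightarrow> (f has_derivative frechet_derivative f (at x)) (at x)"
  by (simp add: differentiable_on_eq_differentiable_at frechet_derivative_works)

lemma Ck_on_add:
  "open U \<Longrightarrow> Ck_on k U f \<Longrightarrow> Ck_on k U g \<Longrightarrow> Ck_on k U (\<lambda>x. f x + g x)"
proof (induction k arbitrary: f g)
  case 0
  then show ?case by (auto intro: continuous_on_add)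
next
  case (Suc k)
  show ?case
    by (rule Ck_on_deriv[where f' = "\<lambda>x v. frechet_derivative f (at x) v + frechet_derivative g (at x) v"])
      (use Suc in \<open>auto intro!: has_derivative_add Ck_on_works\<close>)
qed

lemma (in bounded_bilinear) Ck_on:
  "open U \<Longrightarrow> Ck_on k U f \<Longrightarrow> Ck_on k U g \<Longrightarrow> Ck_on k U (\<lambda>x. prod (f x) (g x))"
proof (induction k arbitrary: f g)
  case 0
  then show ?case by (auto intro: continuous_on)
next
  case (Suc k)
  note ff = Ck_on_mono[OF Suc.prems(2)] Ck_on_mono[OF Suc.prems(3)]
  show ?case
  proof (rule Ck_on_deriv[where f' = "\<lambda>x v. prod (f x) (frechet_derivative g (at x) v)
                                  + prod (frechet_derivative f (at x) v) (g x)"])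
    show "((\<lambda>x. prod (f x) (g x)) has_derivative
        (\<lambda>v. prod (f x) (frechet_derivative g (at x) v) + prod (frechet_derivative f (at x) v) (g x)))
        (at x)" if "x \<in> U" for x
      using FDERIV[OF Ck_on_works[OF Suc.prems(1,2) that] Ck_on_works[OF Suc.prems(1,3) that]] .
  qed (use Suc ff in \<open>auto intro!: Ck_on_add\<close>)
qed

lemmas Ck_on_scaleR = bounded_bilinear.Ck_on[OF bounded_bilinear_scaleR]
  and Ck_on_inner = bounded_bilinear.Ck_on[OF bounded_bilinear_inner]

lemma Ck_on_minus: "open U \<Longrightarrow> Ck_on k U f \<Longrightarrow> Ck_on k U (\<lambda>x. - f x)"
  using Ck_on_scaleR[OF _ Ck_on_const[of U k "-1"]] by fastforce

lemma Ck_on_diff: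
  "open U \<Longrightarrow> Ck_on k U f \<Longrightarrow> Ck_on k U g \<Longrightarrow> Ck_on k U (\<lambda>x. f x - g x)"
  using Ck_on_add[OF _ _ Ck_on_minus, of U k f g] by simp

lemma Ck_on_sum:
  "open U \<Longrightarrow> finite B \<Longrightarrow> (\<And>b. b \<in> B \<Longrightarrow> Ck_on k U (f b)) \<Longrightarrow> Ck_on k U (\<lambda>x. \<Sum>b\<in>B. f b x)"
  by (rotate_tac 1, induction B rule: finite_induct) (auto simp: Ck_on_const intro: Ck_on_add)

lemma Ck_on_directional:
  assumes "open U" "\<forall>k. Ck_on k U g" "\<And>k. Ck_on k U h"
  shows "Ck_on k U (\<lambda>x. frechet_derivative g (at x) (h x))"
proof (rule Ck_on_cong[OF assms(1)])
  show "Ck_on k U (\<lambda>x. \<Sum>b\<in>Basis. (h x \<bullet> b) *\<^sub>R frechet_derivative g (at x) b)"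
    using assms(2) by (intro Ck_on_sum Ck_on_scaleR Ck_on_inner Ck_on_const assms) (auto dest: spec[of _ "Suc k"])
  fix x assume "x \<in> U"
  then have "linear (frechet_derivative g (at x))"
    using Ck_on_works[OF assms(1), of 0 g x] assms(2) has_derivative_linear by blast
  then show "(\<Sum>b\<in>Basis. (h x \<bullet> b) *\<^sub>R frechet_derivative g (at x) b) = frechet_derivative g (at x) (h x)"
    using linear_sum[of "frechet_derivative g (at x)" "\<lambda>b. (h x \<bullet> b) *\<^sub>R b" Basis]
    by (simp add: linear_cmul euclidean_representation)
qed

lemma smooth_on_local:
  assumes "smooth_on A f" "p \<in> A"
  obtains U g where "open U" "p \<in> U" "\<And>k. Ck_on k U g" "\<And>x. x \<in> A \<Longrightarrow> x \<in> U \<Longrightarrow> g x = f x"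
  using assms unfolding smooth_on_def by (metis IntI)

definition proj :: "'a::euclidean_space \<Rightarrow> 'a \<Rightarrow> 'a" where
  "proj p w = w - (p \<bullet> w) *\<^sub>R p"

lemma proj_tangent: "p \<in> unit_sphere \<Longrightarrow> proj p w \<in> tangent p"
  by (simp add: proj_def tangent_def inner_diff_right dot_square_norm)

lemma proj_id: "w \<in> tangent p \<Longrightarrow> proj p w = w"
  by (simp add: proj_def tangent_def)

lemma proj_lin:
  "proj p (v + w) = proj p v + proj p w" "proj p (v - w) = proj p v - proj p w"
  "proj p (a *\<^sub>R v) = a *\<^sub>R proj p v"
  by (auto simp: proj_def inner_add_right inner_diff_right algebra_simps)

lemma proj_inner: "w \<in> tangent p \<Longrightarrow> proj p v \<bullet> w = v \<bullet> w"
  by (simp add: proj_def tangent_def inner_diff_left)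

lemma sgn_sphere: "p \<in> unit_sphere \<Longrightarrow> sgn p = p"
  by (simp add: sgn_div_norm)

lemma has_derivative_sgn:
  assumes "p \<in> unit_sphere"
  shows "(sgn has_derivative proj p) (at (p::'a::euclidean_space))"
proof -
  have np: "norm p = 1" "p \<noteq> 0" using assms by auto
  have "(norm has_derivative (\<bullet>) (sgn p)) (at p)"
    using has_derivative_norm[OF np(2)] by (simp add: inner_commute[of _ "sgn p"])
  then have "((\<lambda>x. inverse (norm x) *\<^sub>R x) has_derivative proj p) (at p)"
    using np sgn_sphere[OF assms]
    by (auto intro!: derivative_eq_intros simp: proj_def fun_eq_iff algebra_simps)
  moreover have "sgn = (\<lambda>x::'a. inverse (norm x) *\<^sub>R x)"
    by (simp add: fun_eq_iff sgn_div_norm)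
  ultimately show ?thesis by simp
qed

lemma sderiv_extension:
  assumes "open U" "p \<in> U" "p \<in> unit_sphere" "(g has_derivative g') (at p)"
    and "\<And>x. x \<in> unit_sphere \<Longrightarrow> x \<in> U \<Longrightarrow> g x = f x"
  shows "((\<lambda>x. f (sgn x)) has_derivative (\<lambda>v. g' (proj p v))) (at p)"
proof -
  have np: "p \<noteq> 0" "sgn p = p" using assms(3) sgn_sphere by auto
  have "((\<lambda>x. g (sgn x)) has_derivative (\<lambda>v. g' (proj p v))) (at p)"
    using has_derivative_compose[OF has_derivative_sgn[OF assms(3)], of g g'] assms(4) np by simp
  moreover have "isCont sgn p"
    using isCont_sgn[of p "\<lambda>x. x"] np by simp
  then have "eventually (\<lambda>x. sgn x \<in> U) (at p)"
    unfolding isCont_def using assms(1,2) np(2) by (simp add: topological_tendstoD)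
  then have "eventually (\<lambda>x. g (sgn x) = f (sgn x)) (at p)"
    using eventually_neq_at_within[of 0]
    by eventually_elim (auto intro!: assms(5) simp: norm_sgn)
  ultimately show ?thesis
    using has_derivative_transform_eventually[where x = p and s = UNIV] assms(2,3,5) np(2) by fastforce
qed

lemma sderiv_works:
  assumes "smooth_on unit_sphere f" "p \<in> unit_sphere"
  shows "((\<lambda>x. f (sgn x)) has_derivative sderiv f p) (at p)"
proof -
  obtain U g where g: "open U" "p \<in> U" "\<And>k. Ck_on k U g"
      "\<And>x. x \<in> unit_sphere \<Longrightarrow> x \<in> U \<Longrightarrow> g x = f x"
    using smooth_on_local[OF assms] by blast
  have "(\<lambda>x. f (sgn x)) differentiable at p"
    using sderiv_extension[OF g(1,2) assms(2) Ck_on_works[OF g(1) g(3)[of "Suc 0"] g(2)] g(4)]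
      differentiable_def by blast
  then have "((\<lambda>x. f (sgn x)) has_derivative frechet_derivative (\<lambda>x. f (sgn x)) (at p)) (at p)"
    using frechet_derivative_works by blast
  then show ?thesis by (simp add: sderiv_def[abs_def])
qed

lemma sderiv_eqI:
  "((\<lambda>x. f (sgn x)) has_derivative f') (at p) \<Longrightarrow> sderiv f p = f'"
  unfolding sderiv_def[abs_def] by (metis frechet_derivative_at)

lemma sderiv_cong:
  assumes "p \<in> unit_sphere" "\<And>x. x \<in> unit_sphere \<Longrightarrow> f x = g x" "smooth_on unit_sphere f"
  shows "sderiv g p = sderiv f p"
proof (rule sderiv_eqI)
  show "((\<lambda>x. g (sgn x)) has_derivative sderiv f p) (at p)"
  proof (rule has_derivative_transform_within_open[OF sderiv_works[OF assms(3,1)]])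
    show "open (- {0::'a})" "p \<in> - {0}" using assms(1) by auto
    show "f (sgn x) = g (sgn x)" if "x \<in> - {0}" for x
      using that by (intro assms(2)) (auto simp: norm_sgn)
  qed
qed

lemma sderiv_linear: "smooth_on unit_sphere f \<Longrightarrow> p \<in> unit_sphere \<Longrightarrow> linear (sderiv f p)"
  using sderiv_works has_derivative_linear by blast

definition sphere_nab :: "'a::euclidean_space \<Rightarrow> 'a \<Rightarrow> ('a \<Rightarrow> 'a) \<Rightarrow> 'a" where
  "sphere_nab p v Y = proj p (sderiv Y p v)"

lemma vfield_sphere_nab:
  assumes "vfield X" "vfield Y"
  shows "vfield (\<lambda>p. sphere_nab p (X p) Y)"
proof -
  have "\<exists>U g. open U \<and> p \<in> U \<and> (\<forall>k. Ck_on k U g) \<and>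
      (\<forall>x\<in>unit_sphere \<inter> U. g x = sphere_nab x (X x) Y)" if p: "p \<in> unit_sphere" for p
  proof -
    obtain U g where g: "open U" "p \<in> U" "\<And>k. Ck_on k U g"
        "\<And>x. x \<in> unit_sphere \<Longrightarrow> x \<in> U \<Longrightarrow> g x = Y x"
      using smooth_on_local[of unit_sphere Y p] assms p unfolding vfield_def by metis
    obtain V h where h: "open V" "p \<in> V" "\<And>k. Ck_on k V h"
        "\<And>x. x \<in> unit_sphere \<Longrightarrow> x \<in> V \<Longrightarrow> h x = X x"
      using smooth_on_local[of unit_sphere X p] assms p unfolding vfield_def by metis
    define W where "W = U \<inter> V"
    have W: "open W" "p \<in> W" "\<And>k. Ck_on k W g" "\<And>k. Ck_on k W h"
      using g(1-3) h(1-3) by (auto simp: W_def intro: Ck_on_subset[OF g(1)] Ck_on_subset[OF h(1)])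
    have "Ck_on k W (\<lambda>x. proj x (frechet_derivative g (at x) (h x)))" for k
      unfolding proj_def using W
      by (intro Ck_on_diff Ck_on_scaleR Ck_on_inner Ck_on_ident Ck_on_directional) auto
    moreover have "proj x (frechet_derivative g (at x) (h x)) = sphere_nab x (X x) Y"
      if x: "x \<in> unit_sphere" "x \<in> W" for x
    proof -
      have "sderiv Y x (X x) = frechet_derivative g (at x) (proj x (X x))"
        using fun_cong[OF sderiv_eqI[OF sderiv_extension[OF W(1) x(2,1)
              Ck_on_works[OF W(1) W(3)[of "Suc 0"] x(2)], of Y]]] g(4) by (simp add: W_def)
      moreover have "proj x (X x) = h x"
        using assms(1) x h(4) by (simp add: W_def vfield_def proj_id)
      ultimately show ?thesis by (simp add: sphere_nab_def)
    qed
    ultimately show ?thesis using W(1,2) by blast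
  qed
  then show ?thesis
    by (auto simp: vfield_def smooth_on_def sphere_nab_def proj_tangent)
qed

lemma levi_civita_sphere_nab: "levi_civita sphere_nab"
proof
  fix X Y Z :: "'a \<Rightarrow> 'a" and f :: "'a \<Rightarrow> real" and p u v :: 'a and a b :: real
  show "vfield X \<Longrightarrow> vfield Y \<Longrightarrow> vfield (\<lambda>p. sphere_nab p (X p) Y)"
    by (rule vfield_sphere_nab)
  assume p: "p \<in> unit_sphere"
  note sw = sderiv_works[OF _ p] and sp = sgn_sphere[OF p]
  assume Y: "vfield Y"
  then have Ys: "smooth_on unit_sphere Y" by (simp add: vfield_def)
  show "sphere_nab p (a *\<^sub>R u + b *\<^sub>R v) Y = a *\<^sub>R sphere_nab p u Y + b *\<^sub>R sphere_nab p v Y"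
    using sderiv_linear[OF Ys p] by (simp add: sphere_nab_def linear_add linear_cmul proj_lin)
  {
    assume f: "smooth_on unit_sphere f"
    have "sderiv (\<lambda>q. f q *\<^sub>R Y q) p = (\<lambda>v. f p *\<^sub>R sderiv Y p v + sderiv f p v *\<^sub>R Y p)"
      by (rule sderiv_eqI)
        (use bounded_bilinear.FDERIV[OF bounded_bilinear_scaleR sw[OF f] sw[OF Ys]] sp in simp)
    then show "sphere_nab p v (\<lambda>q. f q *\<^sub>R Y q) = sderiv f p v *\<^sub>R Y p + f p *\<^sub>R sphere_nab p v Y"
      using Y p proj_id[of "Y p" p] by (simp add: sphere_nab_def proj_lin vfield_def)
  }
  have skew: "sderiv Y p v \<bullet> p + Y p \<bullet> v = 0" if "v \<in> tangent p" "vfield Y" for v Y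
  proof -
    have "sderiv (\<lambda>q. Y q \<bullet> q) p = (\<lambda>v. Y p \<bullet> proj p v + sderiv Y p v \<bullet> p)"
      by (rule sderiv_eqI)
        (use bounded_bilinear.FDERIV[OF bounded_bilinear_inner sw has_derivative_sgn[OF p]] that sp
          in \<open>simp add: vfield_def\<close>)
    moreover have "sderiv (\<lambda>q. Y q \<bullet> q) p = sderiv (\<lambda>q. 0) p"
      using that(2) by (intro sderiv_cong[OF p])
        (auto simp: vfield_def tangent_def inner_commute smooth_on_def intro!: exI[of _ UNIV] exI[of _ "\<lambda>_. 0"] Ck_on_const)
    moreover have "sderiv (\<lambda>q. 0::real) p = (\<lambda>v. 0)"
      by (rule sderiv_eqI) simp
    ultimately show ?thesis
      using proj_id[OF that(1)] by (metis add.commute)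
  qed
  {
    assume X: "vfield X"
    have t: "X p \<in> tangent p" "Y p \<in> tangent p" using X Y p by (auto simp: vfield_def)
    have "lie_bracket X Y p \<in> tangent p"
      using skew[OF t(1) Y] skew[OF t(2) X]
      by (simp add: lie_bracket_def tangent_def inner_diff_right inner_commute)
    then show "sphere_nab p (X p) Y - sphere_nab p (Y p) X = lie_bracket X Y p"
      unfolding sphere_nab_def by (metis lie_bracket_def proj_id proj_lin(2))
  }
  assume Z: "vfield Z"
  then have Zs: "smooth_on unit_sphere Z" by (simp add: vfield_def)
  show "sphere_nab p v Y = sphere_nab p v Z" if "\<And>q. q \<in> unit_sphere \<Longrightarrow> Y q = Z q"
    using sderiv_cong[OF p that Ys] by (simp add: sphere_nab_def)
  have "sderiv (\<lambda>q. Y q + Z q) p = (\<lambda>v. sderiv Y p v + sderiv Z p v)"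
    by (rule sderiv_eqI) (use has_derivative_add[OF sw[OF Ys] sw[OF Zs]] in simp)
  then show "sphere_nab p v (\<lambda>q. Y q + Z q) = sphere_nab p v Y + sphere_nab p v Z"
    by (simp add: sphere_nab_def proj_lin)
  have "sderiv (\<lambda>q. Y q \<bullet> Z q) p = (\<lambda>v. Y p \<bullet> sderiv Z p v + sderiv Y p v \<bullet> Z p)"
    by (rule sderiv_eqI)
      (use bounded_bilinear.FDERIV[OF bounded_bilinear_inner sw[OF Ys] sw[OF Zs]] sp in simp)
  moreover have "Z p \<in> tangent p" "Y p \<in> tangent p" using Y Z p by (auto simp: vfield_def)
  ultimately show "sderiv (\<lambda>q. Y q \<bullet> Z q) p v = sphere_nab p v Y \<bullet> Z p + Y p \<bullet> sphere_nab p v Z"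
    using proj_inner[of "Z p" p] proj_inner[of "Y p" p]
    by (simp add: sphere_nab_def inner_commute)
qed

lemma interval_not_bot:
  assumes "is_interval (I::real set)" "interior I \<noteq> {}" "t \<in> I"
  shows "at t within I \<noteq> bot"
proof -
  have "connected I" "I \<noteq> {t}" using assms by (auto simp: is_interval_connected_1)
  then have "t islimpt I"
    using assms(3) connected_imp_perfect by blast
  then show ?thesis by (simp add: trivial_limit_within)
qed

definition curve_nab ::
  "real set \<Rightarrow> (real \<Rightarrow> 'a::euclidean_space) \<Rightarrow> real \<Rightarrow> real \<Rightarrow> (real \<Rightarrow> 'a) \<Rightarrow> 'a" where
  "curve_nab I \<gamma> t c V = c *\<^sub>R proj (\<gamma> t) (vector_derivative V (at t within I))"

lemma induced_connection_curve_nab: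
  fixes \<gamma> :: "real \<Rightarrow> 'a::euclidean_space"
  assumes I: "is_interval I" "interior I \<noteq> {}" and \<gamma>: "smooth_on I \<gamma>" "\<gamma> \<in> I \<rightarrow> unit_sphere"
  shows "induced_connection sphere_nab I \<gamma> (curve_nab I \<gamma>)"
proof -
  note nb = interval_not_bot[OF I]
  have ext: "vector_derivative f (at t within I) = frechet_derivative g (at t) 1"
      "(f has_vector_derivative vector_derivative f (at t within I)) (at t within I)"
    if "open U" "\<And>k. Ck_on k U g" "\<And>x. x \<in> I \<Longrightarrow> x \<in> U \<Longrightarrow> g x = f x" "t \<in> I" "t \<in> U"
    for f g :: "real \<Rightarrow> 'b::euclidean_space" and U t
  proof -
    have g: "(g has_derivative frechet_derivative g (at t)) (at t)"
      using Ck_on_works[OF that(1) that(2)[of "Suc 0"] that(5)] .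
    then have "frechet_derivative g (at t) = (\<lambda>r. r *\<^sub>R frechet_derivative g (at t) 1)"
      using has_derivative_linear linear_cmul by (metis mult.right_neutral real_scaleR_def)
    then have "(g has_vector_derivative frechet_derivative g (at t) 1) (at t)"
      using g unfolding has_vector_derivative_def by metis
    then have "(g has_vector_derivative frechet_derivative g (at t) 1) (at t within I \<inter> U)"
      using has_vector_derivative_at_within by blast
    then have "(f has_vector_derivative frechet_derivative g (at t) 1) (at t within I \<inter> U)"
      using has_vector_derivative_transform[of t "I \<inter> U" f g] that(3,4,5) by auto
    then have f: "(f has_vector_derivative frechet_derivative g (at t) 1) (at t within I)"
      using at_within_nhd[OF that(5,1), of "I \<inter> U" I] by (simp add: Int_assoc)
    show "vector_derivative f (at t within I) = frechet_derivative g (at t) 1"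
      by (rule vector_derivative_within[OF nb[OF that(4)] f])
    then show "(f has_vector_derivative vector_derivative f (at t within I)) (at t within I)"
      using f by simp
  qed
  have works: "(f has_vector_derivative vector_derivative f (at t within I)) (at t within I)"
    if "smooth_on I f" "t \<in> I" for f :: "real \<Rightarrow> 'b::euclidean_space" and t
    using smooth_on_local[OF that] ext(2) that(2) by metis
  show ?thesis
  proof
    fix V W :: "real \<Rightarrow> 'a" and X f :: "real \<Rightarrow> real" and Y :: "'a \<Rightarrow> 'a" and t a b c d :: real
    show "field_along I \<gamma> (\<lambda>t. curve_nab I \<gamma> t (X t) V)" if X: "smooth_on I X" and V: "field_along I \<gamma> V"
    proof -
      have "\<exists>U h. open U \<and> t \<in> U \<and> (\<forall>k. Ck_on k U h) \<and>
          (\<forall>x\<in>I \<inter> U. h x = curve_nab I \<gamma> x (X x) V)" if t: "t \<in> I" for t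
      proof -
        obtain U g where g: "open U" "t \<in> U" "\<And>k. Ck_on k U g" "\<And>x. x \<in> I \<Longrightarrow> x \<in> U \<Longrightarrow> g x = V x"
          using smooth_on_local[of I V t] V t unfolding field_along_def by metis
        obtain U' h where h: "open U'" "t \<in> U'" "\<And>k. Ck_on k U' h" "\<And>x. x \<in> I \<Longrightarrow> x \<in> U' \<Longrightarrow> h x = X x"
          using smooth_on_local[OF X t] by metis
        obtain U'' c where c: "open U''" "t \<in> U''" "\<And>k. Ck_on k U'' c" "\<And>x. x \<in> I \<Longrightarrow> x \<in> U'' \<Longrightarrow> c x = \<gamma> x"
          using smooth_on_local[OF \<gamma>(1) t] by metis
        define W where "W = U \<inter> U' \<inter> U''"
        have W: "open W" "t \<in> W" "\<And>k. Ck_on k W g" "\<And>k. Ck_on k W h" "\<And>k. Ck_on k W c"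
          using g(1-3) h(1-3) c(1-3)
          by (auto simp: W_def intro: Ck_on_subset[OF g(1)] Ck_on_subset[OF h(1)] Ck_on_subset[OF c(1)])
        have "Ck_on k W (\<lambda>x. h x *\<^sub>R proj (c x) (frechet_derivative g (at x) 1))" for k
          unfolding proj_def using W
          by (intro Ck_on_diff Ck_on_scaleR Ck_on_inner Ck_on_ident Ck_on_directional Ck_on_const) auto
        moreover have "h x *\<^sub>R proj (c x) (frechet_derivative g (at x) 1) = curve_nab I \<gamma> x (X x) V"
          if "x \<in> I" "x \<in> W" for x
          using ext(1)[OF g(1,3,4) that(1)] that h(4) c(4) by (simp add: W_def curve_nab_def)
        ultimately show ?thesis using W(1,2) by blast
      qed
      moreover have "curve_nab I \<gamma> t (X t) V \<in> tangent (\<gamma> t)" if "t \<in> I" for t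
        using \<gamma>(2) that proj_tangent[OF funcset_mem[OF \<gamma>(2) that]] by (simp add: curve_nab_def tangent_def)
      ultimately show ?thesis by (simp add: field_along_def smooth_on_def)
    qed
    assume t: "t \<in> I"
    note vd = vector_derivative_within[OF nb[OF t]]
    show "curve_nab I \<gamma> t c (\<lambda>s. Y (\<gamma> s)) = sphere_nab (\<gamma> t) (c *\<^sub>R velocity I \<gamma> t) Y" if Y: "vfield Y"
    proof -
      have p: "\<gamma> t \<in> unit_sphere" and Ys: "smooth_on unit_sphere Y"
        using t \<gamma>(2) Y by (auto simp: vfield_def)
      have "((\<lambda>x. Y (sgn x)) \<circ> \<gamma> has_vector_derivative sderiv Y (\<gamma> t) (velocity I \<gamma> t)) (at t within I)"
        by (rule vector_derivative_diff_chain_within[OF works[OF \<gamma>(1) t]])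
          (rule has_derivative_at_withinI[OF sderiv_works[OF Ys p]])
      then have "((\<lambda>s. Y (\<gamma> s)) has_vector_derivative sderiv Y (\<gamma> t) (velocity I \<gamma> t)) (at t within I)"
        by (rule has_vector_derivative_transform[OF t, rotated]) (use \<gamma>(2) sgn_sphere in force)
      from vd[OF this] show ?thesis
        using sderiv_linear[OF Ys p] by (simp add: curve_nab_def sphere_nab_def linear_cmul proj_lin)
    qed
    assume V: "field_along I \<gamma> V"
    then have Vw: "(V has_vector_derivative vector_derivative V (at t within I)) (at t within I)"
      and Vt: "V t \<in> tangent (\<gamma> t)"
      using works t by (auto simp: field_along_def)
    show "curve_nab I \<gamma> t (a * c + b * d) V = a *\<^sub>R curve_nab I \<gamma> t c V + b *\<^sub>R curve_nab I \<gamma> t d V"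
      by (simp add: curve_nab_def scaleR_add_left)
    show "curve_nab I \<gamma> t c (\<lambda>s. f s *\<^sub>R V s) =
        (c * vector_derivative f (at t within I)) *\<^sub>R V t + f t *\<^sub>R curve_nab I \<gamma> t c V"
      if f: "smooth_on I f"
    proof -
      have "(f has_field_derivative vector_derivative f (at t within I)) (at t within I)"
        using works[OF f t] by (simp add: has_real_derivative_iff_has_vector_derivative)
      from vd[OF has_vector_derivative_scaleR[OF this Vw]] show ?thesis
        using proj_id[OF Vt] by (simp add: curve_nab_def proj_lin algebra_simps)
    qed
    assume W: "field_along I \<gamma> W"
    then have Ww: "(W has_vector_derivative vector_derivative W (at t within I)) (at t within I)"
      using works t by (auto simp: field_along_def)
    show "curve_nab I \<gamma> t c V = curve_nab I \<gamma> t c W" if "\<And>s. s \<in> I \<Longrightarrow> V s = W s"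
      using vd[OF has_vector_derivative_transform[OF t _ Ww, of V]] that by (simp add: curve_nab_def)
    show "curve_nab I \<gamma> t c (\<lambda>s. V s + W s) = curve_nab I \<gamma> t c V + curve_nab I \<gamma> t c W"
      using vd[OF has_vector_derivative_add[OF Vw Ww]]
      by (simp add: curve_nab_def proj_lin scaleR_add_right)
  qed
qed

end

theory Submission
  imports Defs
begin

text \<open>
  On a one-dimensional flat domain the rough Laplacian is \<open>- \<nabla>\<^sub>T \<nabla>\<^sub>T\<close> with \<open>T = \<gamma>'\<close>, and the tension
  field is \<open>\<nabla>\<^sub>T T\<close>. On the unit sphere \<open>R(V, T) T = V - \<langle>V, T\<rangle> T\<close> for a unit vector \<open>T\<close>, so
  \<open>\<tau>\<^sub>k = (-1)\<^sup>k\<^sup>-\<^sup>1 (\<nabla>\<^sub>T\<^sup>2\<^sup>k\<^sup>-\<^sup>1 T + V - \<langle>V, T\<rangle> T)\<close> with \<open>V = \<nabla>\<^sub>T\<^sup>2\<^sup>k\<^sup>-\<^sup>3 T\<close>. The curvature is obtained by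
  identifying the Levi-Civita connection with the projection of the ambient derivative: the
  projection contributes the two curvature terms, and everything else cancels because second
  derivatives are symmetric.
\<close>

section \<open>Symmetry of second derivatives\<close>

text \<open>Two mean value theorems: one in direction \<open>u\<close> for the increment of
  \<open>f\<close> between the sides \<open>t = 0\<close> and \<open>t = h\<close> of the
  parallelogram, then one in direction \<open>v\<close> for \<open>f' _ u\<close>.\<close>

lemma second_difference_eq_mixed_derivative:
  fixes f :: "'a::real_normed_vector \<Rightarrow> real"
  assumes h: "h > 0" and U: "\<And>s t. s \<in> {0..h} \<Longrightarrow> t \<in> {0..h} \<Longrightarrow> p + s *\<^sub>R u + t *\<^sub>R v \<in> U"
    and f: "\<And>x. x \<in> U \<Longrightarrow> (f has_derivative f' x) (at x)"
    and fu: "\<And>x. x \<in> U \<Longrightarrow> ((\<lambda>y. f' y u) has_derivative Fu x) (at x)"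
  shows "\<exists>s\<in>{0..h}. \<exists>t\<in>{0..h}. f (p + h *\<^sub>R u + h *\<^sub>R v) - f (p + h *\<^sub>R u) - f (p + h *\<^sub>R v) + f p
    = h * h * Fu (p + s *\<^sub>R u + t *\<^sub>R v) v"
proof -
  have lin: "g' (a *\<^sub>R w) = g' w * a" if "(g has_derivative g') (at x)"
    for g g' :: "'a \<Rightarrow> real" and x w a
    using has_derivative_linear[OF that] by (simp add: linear_cmul mult.commute)
  have along_u: "((\<lambda>s. f (p + s *\<^sub>R u + t *\<^sub>R v)) has_real_derivative f' (p + s *\<^sub>R u + t *\<^sub>R v) u) (at s)"
    if "s \<in> {0..h}" "t \<in> {0..h}" for s t
  proof -
    note d = f[OF U[OF that]]
    have "((\<lambda>s. p + s *\<^sub>R u + t *\<^sub>R v) has_derivative (\<lambda>a. a *\<^sub>R u)) (at s)"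
      by (auto intro!: derivative_eq_intros)
    from has_derivative_compose[OF this d] show ?thesis
      by (simp add: has_field_derivative_def lin[OF d])
  qed
  have along_v: "((\<lambda>t. f' (p + s *\<^sub>R u + t *\<^sub>R v) u) has_real_derivative Fu (p + s *\<^sub>R u + t *\<^sub>R v) v) (at t)"
    if "s \<in> {0..h}" "t \<in> {0..h}" for s t
  proof -
    note d = fu[OF U[OF that]]
    have "((\<lambda>t. p + s *\<^sub>R u + t *\<^sub>R v) has_derivative (\<lambda>a. a *\<^sub>R v)) (at t)"
      by (auto intro!: derivative_eq_intros)
    from has_derivative_compose[OF this d] show ?thesis
      by (simp add: has_field_derivative_def lin[OF d])
  qed
  obtain s where s: "0 < s" "s < h"
    "(f (p + h *\<^sub>R u + h *\<^sub>R v) - f (p + h *\<^sub>R u + 0 *\<^sub>R v)) - (f (p + 0 *\<^sub>R u + h *\<^sub>R v) - f (p + 0 *\<^sub>R u + 0 *\<^sub>R v))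
     = (h - 0) * (f' (p + s *\<^sub>R u + h *\<^sub>R v) u - f' (p + s *\<^sub>R u + 0 *\<^sub>R v) u)"
    using MVT2[OF h, of "\<lambda>s. f (p + s *\<^sub>R u + h *\<^sub>R v) - f (p + s *\<^sub>R u + 0 *\<^sub>R v)"
        "\<lambda>s. f' (p + s *\<^sub>R u + h *\<^sub>R v) u - f' (p + s *\<^sub>R u + 0 *\<^sub>R v) u"] h
      DERIV_diff[OF along_u along_u, of _ h 0] by auto
  obtain t where t: "0 < t" "t < h"
    "f' (p + s *\<^sub>R u + h *\<^sub>R v) u - f' (p + s *\<^sub>R u + 0 *\<^sub>R v) u = (h - 0) * Fu (p + s *\<^sub>R u + t *\<^sub>R v) v"
    using MVT2[OF h, of "\<lambda>t. f' (p + s *\<^sub>R u + t *\<^sub>R v) u" "\<lambda>t. Fu (p + s *\<^sub>R u + t *\<^sub>R v) v"]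
      along_v[of s] s(1,2) by auto
  show ?thesis
    using s t by (intro bexI[of _ s] bexI[of _ t]) auto
qed

text \<open>Schwarz's theorem: the second difference is unchanged when \<open>u\<close> and
  \<open>v\<close> are exchanged, so the two mixed derivatives take a common value at points
  arbitrarily near \<open>p\<close>, and continuity carries this to \<open>p\<close>.\<close>

lemma mixed_derivative_symmetric:
  fixes f :: "'a::real_normed_vector \<Rightarrow> real"
  assumes U: "open U" "p \<in> U"
    and f: "\<And>x. x \<in> U \<Longrightarrow> (f has_derivative f' x) (at x)"
    and fu: "\<And>x. x \<in> U \<Longrightarrow> ((\<lambda>y. f' y u) has_derivative Fu x) (at x)"
    and fv: "\<And>x. x \<in> U \<Longrightarrow> ((\<lambda>y. f' y v) has_derivative Fv x) (at x)"
    and cont: "continuous_on U (\<lambda>x. Fu x v)" "continuous_on U (\<lambda>x. Fv x u)"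
  shows "Fu p v = Fv p u"
proof (rule ccontr)
  \<comment> \<open>Half the gap: the common value found in \<open>eq\<close> lies within
    \<open>e\<close> of both mixed derivatives at \<open>p\<close>, which contradicts the triangle
    inequality.\<close>
  define e where "e = dist (Fu p v) (Fv p u) / 2"
  assume "Fu p v \<noteq> Fv p u"
  then have e: "e > 0" by (simp add: e_def)
  have close: "\<exists>d>0. \<forall>x. dist x p < d \<longrightarrow> dist (F x) (F p) < e"
    if "continuous_on U F" for F :: "'a \<Rightarrow> real"
    using that U e by (simp add: continuous_on_eq_continuous_at continuous_at_eps_delta)
  obtain d1 d2 where d: "d1 > 0" "\<And>x. dist x p < d1 \<Longrightarrow> dist (Fu x v) (Fu p v) < e"
      "d2 > 0" "\<And>x. dist x p < d2 \<Longrightarrow> dist (Fv x u) (Fv p u) < e"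
    using close[OF cont(1)] close[OF cont(2)] by blast
  obtain d0 where d0: "d0 > 0" "ball p d0 \<subseteq> U"
    using U openE by blast
  define d where "d = min d0 (min d1 d2)"
  have d_pos: "d > 0" using d d0 by (simp add: d_def)
  \<comment> \<open>The parallelogram spanned by \<open>h *\<^sub>R u\<close> and
    \<open>h *\<^sub>R v\<close> then lies within distance \<open>d\<close> of \<open>p\<close>; the
    \<open>+ 1\<close> keeps the denominator positive when both directions vanish.\<close>
  define h where "h = d / (2 * (norm u + norm v + 1))"
  have n: "0 < norm u + norm v + 1" using norm_ge_zero[of u] norm_ge_zero[of v] by linarith
  then have h: "h > 0" using d_pos by (simp add: h_def)
  have "h * (norm u + norm v + 1) = d / 2" using n by (simp add: h_def field_simps)
  then have hd: "h * norm u + h * norm v < d" using h d_pos by (simp add: algebra_simps)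
  have near: "dist (p + s *\<^sub>R u + t *\<^sub>R v) p < d" if "s \<in> {0..h}" "t \<in> {0..h}" for s t
  proof -
    have "dist (p + s *\<^sub>R u + t *\<^sub>R v) p \<le> norm (s *\<^sub>R u) + norm (t *\<^sub>R v)"
      by (simp add: dist_norm add.assoc norm_triangle_ineq del: norm_scaleR)
    also have "\<dots> \<le> h * norm u + h * norm v"
      using that by (auto intro!: add_mono mult_right_mono)
    finally show ?thesis using hd by simp
  qed
  have inU: "p + s *\<^sub>R u + t *\<^sub>R v \<in> U" if "s \<in> {0..h}" "t \<in> {0..h}" for s t
    using near[OF that] d0(2) by (auto simp: d_def dist_commute)
  obtain s t where st: "s \<in> {0..h}" "t \<in> {0..h}"
      "f (p + h *\<^sub>R u + h *\<^sub>R v) - f (p + h *\<^sub>R u) - f (p + h *\<^sub>R v) + f p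
        = h * h * Fu (p + s *\<^sub>R u + t *\<^sub>R v) v"
    using second_difference_eq_mixed_derivative[OF h inU f fu] by blast
  have inU': "p + s *\<^sub>R v + t *\<^sub>R u \<in> U" if "s \<in> {0..h}" "t \<in> {0..h}" for s t
    using inU[OF that(2,1)] by (simp add: add_ac)
  obtain s' t' where st': "s' \<in> {0..h}" "t' \<in> {0..h}"
      "f (p + h *\<^sub>R v + h *\<^sub>R u) - f (p + h *\<^sub>R v) - f (p + h *\<^sub>R u) + f p
        = h * h * Fv (p + s' *\<^sub>R v + t' *\<^sub>R u) u"
    using second_difference_eq_mixed_derivative[OF h inU' f fv] by blast
  have eq: "Fu (p + s *\<^sub>R u + t *\<^sub>R v) v = Fv (p + t' *\<^sub>R u + s' *\<^sub>R v) u"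
  proof -
    have swap: "p + a *\<^sub>R v + b *\<^sub>R u = p + b *\<^sub>R u + a *\<^sub>R v" for a b
      by (simp add: add_ac)
    have "h * h * Fu (p + s *\<^sub>R u + t *\<^sub>R v) v = h * h * Fv (p + t' *\<^sub>R u + s' *\<^sub>R v) u"
      using st(3) st'(3) unfolding swap by linarith
    then show ?thesis using h by simp
  qed
  have "dist (Fu (p + s *\<^sub>R u + t *\<^sub>R v) v) (Fu p v) < e"
    "dist (Fv (p + t' *\<^sub>R u + s' *\<^sub>R v) u) (Fv p u) < e"
    using near[OF st(1,2)] near[OF st'(2,1)] by (auto intro!: d(2) d(4) simp: d_def)
  then show False
    using dist_triangle3[of "Fu p v" "Fv p u" "Fv (p + t' *\<^sub>R u + s' *\<^sub>R v) u"]
    unfolding eq e_def by linarith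
qed

abbreviation second_deriv ::
  "('a::euclidean_space \<Rightarrow> 'b::real_normed_vector) \<Rightarrow> 'a \<Rightarrow> 'a \<Rightarrow> 'a \<Rightarrow> 'b" where
  "second_deriv g p u v \<equiv> frechet_derivative (\<lambda>x. frechet_derivative g (at x) u) (at p) v"

text \<open>Pairing with basis vectors reduces the claim to real-valued functions, where Schwarz's
  theorem applies.\<close>

lemma second_deriv_symmetric:
  fixes g :: "'a::euclidean_space \<Rightarrow> 'b::euclidean_space"
  assumes U: "open U" "p \<in> U" and g: "\<And>k. Ck_on k U g"
  shows "second_deriv g p u v = second_deriv g p v u"
proof (rule euclidean_eqI)
  fix b :: 'b
  have Ck: "Ck_on k U (\<lambda>x. frechet_derivative g (at x) w)"
      "Ck_on k U (\<lambda>x. second_deriv g x w z)" for k w z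
    using g[of "Suc k"] g[of "Suc (Suc k)"] by auto
  show "second_deriv g p u v \<bullet> b = second_deriv g p v u \<bullet> b"
  proof (rule mixed_derivative_symmetric[OF U])
    show "((\<lambda>x. g x \<bullet> b) has_derivative (\<lambda>w. frechet_derivative g (at x) w \<bullet> b)) (at x)"
      if "x \<in> U" for x
      using Ck_on_works[OF U(1) g[of "Suc 0"] that] by (rule has_derivative_inner_left)
    have "((\<lambda>x. frechet_derivative g (at x) w \<bullet> b) has_derivative (\<lambda>z. second_deriv g x w z \<bullet> b)) (at x)"
      if "x \<in> U" for x w
      using Ck_on_works[OF U(1) Ck(1)[of "Suc 0" w] that] by (rule has_derivative_inner_left)
    then show "x \<in> U \<Longrightarrow> ((\<lambda>x. frechet_derivative g (at x) u \<bullet> b) has_derivative (\<lambda>z. second_deriv g x u z \<bullet> b)) (at x)"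
      "x \<in> U \<Longrightarrow> ((\<lambda>x. frechet_derivative g (at x) v \<bullet> b) has_derivative (\<lambda>z. second_deriv g x v z \<bullet> b)) (at x)" for x
      by blast+
    have "continuous_on U (\<lambda>x. second_deriv g x w z \<bullet> b)" for w z
      using Ck(2)[of 0 w z] by (auto intro: continuous_on_inner)
    then show "continuous_on U (\<lambda>x. second_deriv g x u v \<bullet> b)"
      "continuous_on U (\<lambda>x. second_deriv g x v u \<bullet> b)"
      by blast+
  qed
qed

text \<open>
  Symmetry turns the derivative of \<open>x \<mapsto> dg\<^sub>x(b)\<close> in direction \<open>v\<close> into an expression linear in \<open>b\<close>,
  so that the coordinates of \<open>h\<close> need not appear in the product rule.
\<close>
lemma has_derivative_directional:
  fixes g :: "'a::euclidean_space \<Rightarrow> 'b::euclidean_space"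
  assumes U: "open U" "p \<in> U" and g: "\<And>k. Ck_on k U g"
    and h: "(h has_derivative h') (at p)"
  shows "((\<lambda>x. frechet_derivative g (at x) (h x)) has_derivative
    (\<lambda>v. second_deriv g p v (h p) + frechet_derivative g (at p) (h' v))) (at p)"
proof -
  have Ck: "Ck_on k U (\<lambda>x. frechet_derivative g (at x) w)" for k w
    using g[of "Suc k"] by simp
  have expand: "L w = (\<Sum>b\<in>Basis. (w \<bullet> b) *\<^sub>R L b)" if "linear L" for L :: "'a \<Rightarrow> 'b" and w
    using linear_sum[OF that, of "\<lambda>b. (w \<bullet> b) *\<^sub>R b" Basis] that
    by (simp add: linear_cmul euclidean_representation)
  have lin1: "linear (frechet_derivative g (at x))" if "x \<in> U" for x
    using Ck_on_works[OF U(1) g[of "Suc 0"] that] by (rule has_derivative_linear)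
  have lin2: "linear (second_deriv g p w)" for w
    using Ck_on_works[OF U(1) Ck[of "Suc 0" w] U(2)] by (rule has_derivative_linear)
  have "((\<lambda>x. \<Sum>b\<in>Basis. (h x \<bullet> b) *\<^sub>R frechet_derivative g (at x) b) has_derivative
      (\<lambda>v. \<Sum>b\<in>Basis. (h p \<bullet> b) *\<^sub>R second_deriv g p b v + (h' v \<bullet> b) *\<^sub>R frechet_derivative g (at p) b)) (at p)"
    by (intro has_derivative_sum has_derivative_scaleR has_derivative_inner_left h
        Ck_on_works[OF U(1) Ck[of "Suc 0"] U(2)])
  moreover have "(\<Sum>b\<in>Basis. (h p \<bullet> b) *\<^sub>R second_deriv g p b v + (h' v \<bullet> b) *\<^sub>R frechet_derivative g (at p) b)
      = second_deriv g p v (h p) + frechet_derivative g (at p) (h' v)" for v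
    by (simp add: sum.distrib second_deriv_symmetric[OF U g, of _ v]
        expand[OF lin2, of v "h p"] expand[OF lin1[OF U(2)], of "h' v"])
  ultimately have "((\<lambda>x. \<Sum>b\<in>Basis. (h x \<bullet> b) *\<^sub>R frechet_derivative g (at x) b) has_derivative
      (\<lambda>v. second_deriv g p v (h p) + frechet_derivative g (at p) (h' v))) (at p)"
    by (simp only:)
  then show ?thesis
    by (rule has_derivative_transform_within_open[OF _ U]) (simp add: expand[OF lin1])
qed


section \<open>The curvature of the sphere\<close>

lemma smooth_on_Ck: "(\<And>k. Ck_on k UNIV f) \<Longrightarrow> smooth_on A f"
  unfolding smooth_on_def by blast

text \<open>Supplies the test fields below: projecting a constant vector extends any tangent vector
  at a point to a field on the whole sphere.\<close>

lemma vfield_proj: "vfield (\<lambda>q. proj q u)"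
  unfolding vfield_def using proj_tangent
  by (auto intro!: smooth_on_Ck Ck_on_diff Ck_on_scaleR Ck_on_inner Ck_on_ident Ck_on_const simp: proj_def[abs_def])

lemma vfield_tangent: "vfield X \<Longrightarrow> p \<in> unit_sphere \<Longrightarrow> X p \<in> tangent p"
  by (simp add: vfield_def)

text \<open>Differentiate \<open>Y q \<bullet> q = 0\<close> along the sphere. The normal part of
  the ambient derivative is the second fundamental form of the unit sphere.\<close>

lemma sderiv_inner_position:
  assumes "vfield Y" "p \<in> unit_sphere" "v \<in> tangent p"
  shows "sderiv Y p v \<bullet> p = - (Y p \<bullet> v)"
proof -
  have Ys: "smooth_on unit_sphere Y" using assms(1) by (simp add: vfield_def)
  have "sderiv (\<lambda>q. Y q \<bullet> q) p = (\<lambda>v. Y p \<bullet> proj p v + sderiv Y p v \<bullet> p)"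
    using bounded_bilinear.FDERIV[OF bounded_bilinear_inner sderiv_works[OF Ys assms(2)]
        has_derivative_sgn[OF assms(2)]] sgn_sphere[OF assms(2)]
    by (intro sderiv_eqI) simp
  moreover have "sderiv (\<lambda>q. Y q \<bullet> q) p = sderiv (\<lambda>q. 0) p"
    using vfield_tangent[OF assms(1)]
    by (intro sderiv_cong[OF assms(2)]) (auto simp: tangent_def inner_commute intro: smooth_on_Ck Ck_on_const)
  moreover have "sderiv (\<lambda>q. 0::real) p = (\<lambda>v. 0)"
    by (rule sderiv_eqI) simp
  ultimately have "Y p \<bullet> v + sderiv Y p v \<bullet> p = 0"
    using proj_id[OF assms(3)] by metis
  then show ?thesis by simp
qed

text \<open>Both ambient derivatives have the normal component \<open>- (X p \<bullet> Y p)\<close>,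
  which cancels in the difference.\<close>

lemma lie_bracket_tangent:
  assumes "vfield X" "vfield Y" "p \<in> unit_sphere"
  shows "lie_bracket X Y p \<in> tangent p"
  using sderiv_inner_position[OF assms(1,3) vfield_tangent[OF assms(2,3)]]
    sderiv_inner_position[OF assms(2,3) vfield_tangent[OF assms(1,3)]]
  by (simp add: lie_bracket_def tangent_def inner_diff_right inner_commute)

text \<open>The Gauss equation, computed with local ambient extensions: second derivatives of
  \<open>z\<close> cancel by symmetry, the terms with derivatives of \<open>X\<close> and
  \<open>Y\<close> cancel against the Lie bracket, and the derivative of the projection
  remains.\<close>

lemma curvature_field_sphere_nab:
  assumes X: "vfield X" and Y: "vfield Y" and Z: "vfield Z" and p: "p \<in> unit_sphere"
  shows "curvature_field sphere_nab X Y Z p = (Y p \<bullet> Z p) *\<^sub>R X p - (X p \<bullet> Z p) *\<^sub>R Y p"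
proof -
  obtain U1 x where x: "open U1" "p \<in> U1" "\<And>k. Ck_on k U1 x" "\<And>q. q \<in> unit_sphere \<Longrightarrow> q \<in> U1 \<Longrightarrow> x q = X q"
    using smooth_on_local[of unit_sphere X p] X p unfolding vfield_def by metis
  obtain U2 y where y: "open U2" "p \<in> U2" "\<And>k. Ck_on k U2 y" "\<And>q. q \<in> unit_sphere \<Longrightarrow> q \<in> U2 \<Longrightarrow> y q = Y q"
    using smooth_on_local[of unit_sphere Y p] Y p unfolding vfield_def by metis
  obtain U3 z where z: "open U3" "p \<in> U3" "\<And>k. Ck_on k U3 z" "\<And>q. q \<in> unit_sphere \<Longrightarrow> q \<in> U3 \<Longrightarrow> z q = Z q"
    using smooth_on_local[of unit_sphere Z p] Z p unfolding vfield_def by metis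
  define W where "W = U1 \<inter> U2 \<inter> U3"
  have W: "open W" "p \<in> W" using x y z by (auto simp: W_def)
  have Ck: "Ck_on k W x" "Ck_on k W y" "Ck_on k W z" for k
    using x(1,3) y(1,3) z(1,3) W(1) by (auto intro: Ck_on_subset simp: W_def)
  \<comment> \<open>Since \<open>v\<close> is tangent, the projection coming from the derivative of
    \<open>sgn\<close> disappears, leaving the ordinary derivative of a local extension.\<close>
  have sd: "sderiv A q v = frechet_derivative a (at q) v"
    if "vfield A" "\<And>k. Ck_on k W a" "\<And>q. q \<in> unit_sphere \<Longrightarrow> q \<in> W \<Longrightarrow> a q = A q"
      "q \<in> unit_sphere" "q \<in> W" "v \<in> tangent q" for A a :: "'a \<Rightarrow> 'a" and q v
    using fun_cong[OF sderiv_eqI[OF sderiv_extension[OF W(1) that(5,4)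
          Ck_on_works[OF W(1) that(2)[of "Suc 0"] that(5)] that(3)]], of v] proj_id[OF that(6)] by simp
  let ?z' = "frechet_derivative z (at p)"
  \<comment> \<open>Differentiating \<open>proj q\<close> in its base point yields a multiple of
    \<open>p\<close>, killed by the outer projection, and a multiple of \<open>v\<close>, whose
    coefficient is the normal part of the ambient derivative of \<open>Z\<close>. The latter is the
    curvature contribution.\<close>
  have second: "sphere_nab p v (\<lambda>q. sphere_nab q (B q) Z)
      = proj p (second_deriv z p v (B p) + ?z' (sderiv B p v)) + (Z p \<bullet> B p) *\<^sub>R v"
    if B: "vfield B" "\<And>k. Ck_on k W b" "\<And>q. q \<in> unit_sphere \<Longrightarrow> q \<in> W \<Longrightarrow> b q = B q"
      and v: "v \<in> tangent p" for B b v
  proof -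
    let ?k = "\<lambda>q. frechet_derivative z (at q) (b q)"
    let ?k' = "\<lambda>v. second_deriv z p v (b p) + ?z' (frechet_derivative b (at p) v)"
    have k: "(?k has_derivative ?k') (at p)"
      by (rule has_derivative_directional[OF W Ck(3) Ck_on_works[OF W(1) B(2)[of "Suc 0"] W(2)]])
    have k_eq: "?k q = sderiv Z q (B q)" if "q \<in> unit_sphere" "q \<in> W" for q
      using sd[OF Z Ck(3) _ that vfield_tangent[OF B(1) that(1)]] z(4) B(3)[OF that] by (simp add: W_def)
    have "((\<lambda>q. proj q (?k q)) has_derivative
        (\<lambda>v. ?k' v - ((p \<bullet> ?k p) *\<^sub>R v + (p \<bullet> ?k' v + v \<bullet> ?k p) *\<^sub>R p))) (at p)"
      unfolding proj_def
      by (intro has_derivative_diff has_derivative_scaleR has_derivative_inner k has_derivative_ident)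
    from sderiv_eqI[OF sderiv_extension[OF W p this, of "\<lambda>q. sphere_nab q (B q) Z"]]
    have "sderiv (\<lambda>q. sphere_nab q (B q) Z) p v
        = ?k' v - ((p \<bullet> ?k p) *\<^sub>R v + (p \<bullet> ?k' v + v \<bullet> ?k p) *\<^sub>R p)"
      by (simp add: k_eq sphere_nab_def proj_id[OF v])
    moreover have "proj p p = 0" using p by (simp add: proj_def dot_square_norm)
    ultimately have "sphere_nab p v (\<lambda>q. sphere_nab q (B q) Z) = proj p (?k' v) - (p \<bullet> ?k p) *\<^sub>R v"
      unfolding sphere_nab_def using proj_id[OF v] by (simp only: proj_lin) simp
    moreover have "p \<bullet> ?k p = - (Z p \<bullet> B p)"
      using sderiv_inner_position[OF Z p vfield_tangent[OF B(1) p]] k_eq[OF p W(2)]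
      by (simp add: inner_commute)
    moreover have "?k' v = second_deriv z p v (B p) + ?z' (sderiv B p v)"
      using sd[OF B p W(2) v] B(3)[OF p W(2)] by simp
    ultimately show ?thesis by simp
  qed
  have xy: "\<And>q. q \<in> unit_sphere \<Longrightarrow> q \<in> W \<Longrightarrow> x q = X q" "\<And>q. q \<in> unit_sphere \<Longrightarrow> q \<in> W \<Longrightarrow> y q = Y q"
    "\<And>q. q \<in> unit_sphere \<Longrightarrow> q \<in> W \<Longrightarrow> z q = Z q"
    using x(4) y(4) z(4) by (auto simp: W_def)
  have lin: "linear ?z'"
    using Ck_on_works[OF W(1) Ck(3)[of "Suc 0"] W(2)] by (rule has_derivative_linear)
  have "sphere_nab p (lie_bracket X Y p) Z = proj p (?z' (sderiv Y p (X p)) - ?z' (sderiv X p (Y p)))"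
    unfolding sphere_nab_def using sd[OF Z Ck(3) xy(3) p W(2) lie_bracket_tangent[OF X Y p]]
    by (simp add: lie_bracket_def linear_diff[OF lin])
  moreover have "sphere_nab p (X p) (\<lambda>q. sphere_nab q (Y q) Z)
      = proj p (second_deriv z p (X p) (Y p) + ?z' (sderiv Y p (X p))) + (Z p \<bullet> Y p) *\<^sub>R X p"
    by (rule second[OF Y Ck(2) _ vfield_tangent[OF X p]]) (rule xy(2))
  moreover have "sphere_nab p (Y p) (\<lambda>q. sphere_nab q (X q) Z)
      = proj p (second_deriv z p (Y p) (X p) + ?z' (sderiv X p (Y p))) + (Z p \<bullet> X p) *\<^sub>R Y p"
    by (rule second[OF X Ck(1) _ vfield_tangent[OF Y p]]) (rule xy(1))
  ultimately show ?thesis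
    by (simp add: curvature_field_def proj_lin second_deriv_symmetric[OF W Ck(3), of "Y p" "X p"] inner_commute)
qed


section \<open>Uniqueness of the Levi-Civita connection\<close>

context levi_civita
begin

text \<open>Consider the difference \<open>A\<close> of the two connections. They share the Lie
  bracket, so \<open>A\<close> is symmetric; they share the derivative of inner products, so
  \<open>A\<close> is skew in the last two slots.\<close>

lemma nab_eq_sphere_nab:
  assumes Y: "vfield Y" and p: "p \<in> unit_sphere" and v: "v \<in> tangent p"
  shows "nab p v Y = sphere_nab p v Y"
proof -
  interpret S: levi_civita sphere_nab by (rule levi_civita_sphere_nab)
  define A where "A X Y = nab p (X p) Y - sphere_nab p (X p) Y" for X Y
  define X where "X q = proj q v" for q
  have X: "vfield X" "X p = v"
    using vfield_proj proj_id[OF v] by (auto simp: X_def[abs_def])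
  \<comment> \<open>\<open>Z\<close> extends the vector \<open>A X Y\<close> itself, so that
    \<open>A X Y \<bullet> Z p\<close> becomes its squared norm.\<close>
  define Z where "Z q = proj q (A X Y)" for q
  have "A X Y \<in> tangent p"
    using vfield_tangent[OF nab_vfield[OF X(1) Y] p] vfield_tangent[OF S.nab_vfield[OF X(1) Y] p]
    by (simp add: A_def tangent_def inner_diff_right)
  then have Z: "vfield Z" "Z p = A X Y"
    using vfield_proj proj_id by (auto simp: Z_def[abs_def])
  have sym: "A X Y = A Y X" if "vfield X" "vfield Y" for X Y
    using torsion_free[OF that p] S.torsion_free[OF that p] unfolding A_def by (simp add: algebra_simps)
  have skew: "A X Y \<bullet> Z p = - (A X Z \<bullet> Y p)" if "vfield X" "vfield Y" "vfield Z" for X Y Z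
    using metric[OF that(2,3) p vfield_tangent[OF that(1) p]]
      S.metric[OF that(2,3) p vfield_tangent[OF that(1) p]]
    by (simp add: A_def inner_diff_left inner_diff_right inner_commute)
  \<comment> \<open>A trilinear form symmetric in its first two and skew in its last two arguments vanishes.\<close>
  have "A X Y \<bullet> Z p = 0"
    using skew[OF X(1) Y Z(1)] skew[OF Z(1) X(1) Y] skew[OF Y Z(1) X(1)]
      sym[OF X(1) Y] sym[OF Y Z(1)] sym[OF Z(1) X(1)] by simp
  then show ?thesis using Z(2) X(2) by (simp add: A_def)
qed

text \<open>The curvature of fields at \<open>p\<close> depends only on their values there, so the
  definite description in \<open>curvature\<close> has a unique solution; projected constant vectors
  realise the prescribed values.\<close>

lemma curvature_eq:
  assumes p: "p \<in> unit_sphere" and "u \<in> tangent p" "v \<in> tangent p" "w \<in> tangent p"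
  shows "curvature nab p u v w = (v \<bullet> w) *\<^sub>R u - (u \<bullet> w) *\<^sub>R v"
proof -
  interpret S: levi_civita sphere_nab by (rule levi_civita_sphere_nab)
  \<comment> \<open>The connections agree only at points of the sphere in tangent directions, so the
    inner derivative is exchanged through \<open>nab_cong\<close> rather than by rewriting under the
    binder.\<close>
  have second: "nab p (X p) (\<lambda>q. nab q (Y q) Z) = sphere_nab p (X p) (\<lambda>q. sphere_nab q (Y q) Z)"
    if "vfield X" "vfield Y" "vfield Z" for X Y Z
  proof -
    have t: "X p \<in> tangent p" using vfield_tangent[OF that(1) p] .
    show ?thesis
      unfolding nab_eq_sphere_nab[OF nab_vfield[OF that(2,3)] p t]
      by (rule S.nab_cong[OF nab_vfield[OF that(2,3)] S.nab_vfield[OF that(2,3)] _ p t])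
        (rule nab_eq_sphere_nab[OF that(3) _ vfield_tangent[OF that(2)]])
  qed
  have field: "curvature_field nab X Y Z p = (Y p \<bullet> Z p) *\<^sub>R X p - (X p \<bullet> Z p) *\<^sub>R Y p"
    if "vfield X" "vfield Y" "vfield Z" for X Y Z
    using curvature_field_sphere_nab[OF that p] that
      nab_eq_sphere_nab[OF that(3) p lie_bracket_tangent[OF that(1,2) p]]
    by (simp add: curvature_field_def second)
  show ?thesis
    unfolding curvature_def
  proof (rule the_equality)
    let ?E = "\<lambda>u q. proj q u"
    have "?E u p = u" "?E v p = v" "?E w p = w" using assms by (simp_all add: proj_id)
    then show "\<exists>X Y Z. vfield X \<and> vfield Y \<and> vfield Z \<and> X p = u \<and> Y p = v \<and> Z p = w \<and>
        (v \<bullet> w) *\<^sub>R u - (u \<bullet> w) *\<^sub>R v = curvature_field nab X Y Z p"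
      using field[OF vfield_proj vfield_proj vfield_proj, of u v w]
        vfield_proj[of u] vfield_proj[of v] vfield_proj[of w]
      by - (rule exI[of _ "?E u"], rule exI[of _ "?E v"], rule exI[of _ "?E w"], simp)
  qed (use field in auto)
qed

end


section \<open>Curves\<close>

lemma smooth_on_cong: "smooth_on A f \<Longrightarrow> (\<And>x. x \<in> A \<Longrightarrow> f x = g x) \<Longrightarrow> smooth_on A g"
  unfolding smooth_on_def by (metis IntD1)

lemma smooth_on_const: "smooth_on A (\<lambda>x. c)"
  by (simp add: smooth_on_Ck Ck_on_const)

lemma smooth_on_scaleR_const:
  assumes "smooth_on A f"
  shows "smooth_on A (\<lambda>x. a *\<^sub>R f x)"
  unfolding smooth_on_def
proof
  fix p assume "p \<in> A"
  then obtain U g where "open U" "p \<in> U" "\<And>k. Ck_on k U g" "\<And>x. x \<in> A \<Longrightarrow> x \<in> U \<Longrightarrow> g x = f x"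
    using smooth_on_local[OF assms] by metis
  then show "\<exists>U g. open U \<and> p \<in> U \<and> (\<forall>k. Ck_on k U g) \<and> (\<forall>x\<in>A \<inter> U. g x = a *\<^sub>R f x)"
    by (intro exI[of _ U] exI[of _ "\<lambda>x. a *\<^sub>R g x"]) (auto intro!: Ck_on_scaleR Ck_on_const)
qed

lemma field_along_cong:
  "field_along I \<gamma> V \<Longrightarrow> (\<And>t. t \<in> I \<Longrightarrow> V t = W t) \<Longrightarrow> field_along I \<gamma> W"
  unfolding field_along_def using smooth_on_cong by metis

lemma field_along_scaleR: "field_along I \<gamma> V \<Longrightarrow> field_along I \<gamma> (\<lambda>t. a *\<^sub>R V t)"
  by (simp add: field_along_def smooth_on_scaleR_const tangent_def)

text \<open>At an end point of \<open>I\<close> the derivative is one-sided; \<open>nontriv\<close>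
  makes it unique, hence equal to the two-sided derivative of the extension.\<close>

lemma vector_derivative_extension:
  fixes f g :: "real \<Rightarrow> 'b::euclidean_space"
  assumes nontriv: "at t within I \<noteq> bot" and t: "t \<in> I" "t \<in> U" and U: "open U"
    and g: "\<And>k. Ck_on k U g" "\<And>x. x \<in> I \<Longrightarrow> x \<in> U \<Longrightarrow> g x = f x"
  shows "(f has_vector_derivative frechet_derivative g (at t) 1) (at t within I)"
    and "vector_derivative f (at t within I) = frechet_derivative g (at t) 1"
proof -
  have "g differentiable (at t)"
    using Ck_on_works[OF U g(1)[of "Suc 0"] t(2)] by (rule differentiableI)
  then have "(g has_vector_derivative frechet_derivative g (at t) 1) (at t)"
    using frechet_derivative_eq_vector_derivative vector_derivative_works by fastforce
  then have "(g has_vector_derivative frechet_derivative g (at t) 1) (at t within I \<inter> U)"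
    using has_vector_derivative_at_within by blast
  then have "(f has_vector_derivative frechet_derivative g (at t) 1) (at t within I \<inter> U)"
    using has_vector_derivative_transform[of t "I \<inter> U" f g] g(2) t by auto
  then show "(f has_vector_derivative frechet_derivative g (at t) 1) (at t within I)"
    using at_within_nhd[OF t(2) U, of "I \<inter> U" I] by (simp add: Int_assoc)
  then show "vector_derivative f (at t within I) = frechet_derivative g (at t) 1"
    by (rule vector_derivative_within[OF nontriv])
qed

text \<open>Smoothness is inherited from the derivative of a local extension of \<gamma>; tangency
  comes from differentiating \<open>\<gamma> t \<bullet> \<gamma> t = 1\<close> within
  \<open>I\<close>.\<close>

lemma field_along_velocity:
  fixes \<gamma> :: "real \<Rightarrow> 'a::euclidean_space"
  assumes I: "is_interval I" "interior I \<noteq> {}" and \<gamma>: "smooth_on I \<gamma>" "\<gamma> \<in> I \<rightarrow> unit_sphere"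
  shows "field_along I \<gamma> (velocity I \<gamma>)"
  unfolding field_along_def
proof
  note ext = vector_derivative_extension[OF interval_not_bot[OF I]]
  show "smooth_on I (velocity I \<gamma>)"
    unfolding smooth_on_def
  proof
    fix t assume t: "t \<in> I"
    obtain U g where g: "open U" "t \<in> U" "\<And>k. Ck_on k U g" "\<And>x. x \<in> I \<Longrightarrow> x \<in> U \<Longrightarrow> g x = \<gamma> x"
      using smooth_on_local[OF \<gamma>(1) t] by metis
    have "Ck_on k U (\<lambda>x. frechet_derivative g (at x) 1)" for k
      using g(3)[of "Suc k"] by simp
    moreover have "frechet_derivative g (at x) 1 = velocity I \<gamma> x" if "x \<in> I" "x \<in> U" for x
      using ext(2)[OF that(1) that g(1,3,4)] by simp
    ultimately show "\<exists>U g. open U \<and> t \<in> U \<and> (\<forall>k. Ck_on k U g) \<and> (\<forall>x\<in>I \<inter> U. g x = velocity I \<gamma> x)"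
      using g(1,2) by blast
  qed
  show "\<forall>t\<in>I. velocity I \<gamma> t \<in> tangent (\<gamma> t)"
  proof
    fix t assume t: "t \<in> I"
    obtain U g where g: "open U" "t \<in> U" "\<And>k. Ck_on k U g" "\<And>x. x \<in> I \<Longrightarrow> x \<in> U \<Longrightarrow> g x = \<gamma> x"
      using smooth_on_local[OF \<gamma>(1) t] by metis
    have d: "(\<gamma> has_vector_derivative velocity I \<gamma> t) (at t within I)"
      using ext[OF t t g(2,1,3,4)] by simp
    have "((\<lambda>t. \<gamma> t \<bullet> \<gamma> t) has_vector_derivative \<gamma> t \<bullet> velocity I \<gamma> t + velocity I \<gamma> t \<bullet> \<gamma> t) (at t within I)"
      by (rule bounded_bilinear.has_vector_derivative[OF bounded_bilinear_inner d d])
    moreover have "((\<lambda>t. \<gamma> t \<bullet> \<gamma> t) has_vector_derivative 0) (at t within I)"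
      by (rule has_vector_derivative_transform[OF t _ has_vector_derivative_const[of 1]])
        (use \<gamma>(2) in \<open>force simp: dot_square_norm\<close>)
    ultimately have "\<gamma> t \<bullet> velocity I \<gamma> t + velocity I \<gamma> t \<bullet> \<gamma> t = 0"
      using vector_derivative_within[OF interval_not_bot[OF I t]] by metis
    then show "velocity I \<gamma> t \<in> tangent (\<gamma> t)"
      by (simp add: tangent_def inner_commute)
  qed
qed

lemma nabla_euclid_e1:
  assumes "is_interval I" "interior I \<noteq> {}" "t \<in> I"
  shows "nabla_euclid I e1 e1 t = 0"
  using vector_derivative_within[OF interval_not_bot[OF assms] has_vector_derivative_const[of 1]]
  by (simp add: nabla_euclid_def e1_def[abs_def])

section \<open>Rough Laplacian and tension field through the covariant derivative along the
  curve\<close>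

context induced_connection
begin

abbreviation "D \<equiv> cov_deriv nb"

lemma nb_zero: "field_along I \<gamma> V \<Longrightarrow> t \<in> I \<Longrightarrow> nb t 0 V = 0"
  using nb_linear[of V t 0 0 0 0] by simp

lemma field_along_cov_deriv: "field_along I \<gamma> V \<Longrightarrow> field_along I \<gamma> (D V)"
  using nb_field[OF smooth_on_const[of _ 1]] by (simp add: cov_deriv_def[abs_def])

text \<open>The Leibniz rule with a constant factor. Equality is asked for on \<open>I\<close> only,
  because the axioms determine nothing about fields off \<open>I\<close>.\<close>

lemma cov_deriv_cong_scaleR:
  assumes I: "is_interval I" "interior I \<noteq> {}"
    and V: "field_along I \<gamma> V" and W_eq: "\<And>s. s \<in> I \<Longrightarrow> W s = a *\<^sub>R V s" and t: "t \<in> I"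
  shows "D W t = a *\<^sub>R D V t"
proof -
  have W: "field_along I \<gamma> W"
    by (rule field_along_cong[OF field_along_scaleR[OF V, of a]]) (simp add: W_eq)
  have "D W t = D (\<lambda>s. a *\<^sub>R V s) t"
    unfolding cov_deriv_def
    by (rule nb_cong[OF W field_along_scaleR[OF V] _ t]) (simp add: W_eq)
  then show ?thesis
    using nb_leibniz[OF smooth_on_const[of I a] V t, of 1]
      vector_derivative_within[OF interval_not_bot[OF I t] has_vector_derivative_const[of a]]
    by (simp add: cov_deriv_def)
qed

lemma rough_laplacian_eq:
  assumes "is_interval I" "interior I \<noteq> {}" "field_along I \<gamma> V" "t \<in> I"
  shows "rough_laplacian I nb V t = - D (D V) t"
  using nb_zero[OF assms(3,4)] nabla_euclid_e1[OF assms(1,2,4)]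
  by (simp add: rough_laplacian_def cov_deriv_def[abs_def] e1_def)

lemma field_along_iterate: "field_along I \<gamma> V \<Longrightarrow> field_along I \<gamma> (((D \<circ> D) ^^ j) V)"
  by (induction j) (simp_all add: field_along_cov_deriv)

text \<open>Each Laplacian contributes one sign. The start \<open>W\<close> may differ from
  \<open>V\<close> off \<open>I\<close>, since the tension field is identified with the derivative
  of the velocity only on \<open>I\<close>.\<close>

lemma rough_laplacian_iterate:
  assumes I: "is_interval I" "interior I \<noteq> {}" and V: "field_along I \<gamma> V"
    and W: "\<And>s. s \<in> I \<Longrightarrow> W s = V s"
  shows "t \<in> I \<Longrightarrow> (rough_laplacian I nb ^^ j) W t = (-1) ^ j *\<^sub>R ((D \<circ> D) ^^ j) V t"
proof (induction j arbitrary: t)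
  case 0
  then show ?case by (simp add: W)
next
  case (Suc j)
  let ?A = "(rough_laplacian I nb ^^ j) W" and ?B = "((D \<circ> D) ^^ j) V"
  have B: "field_along I \<gamma> ?B" by (rule field_along_iterate[OF V])
  have A: "field_along I \<gamma> ?A"
    by (rule field_along_cong[OF field_along_scaleR[OF B, of "(-1) ^ j"]]) (rule Suc.IH[symmetric])
  \<comment> \<open>The sign is first pulled out of the inner derivative at every point of
    \<open>I\<close>, then out of the outer one at \<open>t\<close>.\<close>
  have "D (D ?A) t = (-1) ^ j *\<^sub>R D (D ?B) t"
    by (rule cov_deriv_cong_scaleR[OF I field_along_cov_deriv[OF B] _ Suc.prems],
        rule cov_deriv_cong_scaleR[OF I B Suc.IH])
  then show ?case by (simp add: rough_laplacian_eq[OF I A Suc.prems] comp_def)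
qed

lemma tension_eq:
  assumes "is_interval I" "interior I \<noteq> {}" "t \<in> I"
  shows "tension I \<gamma> nb t = D (velocity I \<gamma>) t"
  using nabla_euclid_e1[OF assms]
  by (simp add: tension_def differential_def[abs_def] cov_deriv_def e1_def)

end

theorem theorem7p1:
  fixes n k :: nat
    and I :: "real set"
    and \<gamma> :: "real \<Rightarrow> 'a::euclidean_space"
    and nab :: "'a \<Rightarrow> 'a \<Rightarrow> ('a \<Rightarrow> 'a) \<Rightarrow> 'a"
    and nb :: "real \<Rightarrow> real \<Rightarrow> (real \<Rightarrow> 'a) \<Rightarrow> 'a"
  assumes "DIM('a) = n + 1"
    and "k \<ge> 2"
    and "levi_civita nab"
    and "is_interval I" and "interior I \<noteq> {}"
    and "smooth_on I \<gamma>" and "\<gamma> \<in> I \<rightarrow> unit_sphere"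
    and "\<And>t. t \<in> I \<Longrightarrow> norm (velocity I \<gamma> t) = 1"
    and "induced_connection nab I \<gamma> nb"
  defines "D \<equiv> cov_deriv nb"
    and "T \<equiv> velocity I \<gamma>"
  shows "k_harmonic_curve nab I \<gamma> nb k \<longleftrightarrow>
    (\<forall>t\<in>I. ((D \<circ> D) ^^ (k - 1)) (D T) t + ((D \<circ> D) ^^ (k - 2)) (D T) t
       - (((D \<circ> D) ^^ (k - 2)) (D T) t \<bullet> T t) *\<^sub>R T t = 0)"
proof -
  interpret levi_civita nab by fact
  interpret induced_connection nab I \<gamma> nb by fact
  note I = assms(4,5)
  \<comment> \<open>This removes the truncated subtractions: \<open>k - 2\<close> is
    \<open>m\<close> and \<open>k - 1\<close> is \<open>Suc m\<close>.\<close>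
  obtain m where k: "k = m + 2" using assms(2) by (metis add.commute le_Suc_ex)
  have T: "field_along I \<gamma> T"
    using field_along_velocity[OF I assms(6,7)] by (simp add: T_def)
  have DT: "field_along I \<gamma> (D T)"
    using field_along_cov_deriv[OF T] by (simp add: D_def)
  let ?V = "((D \<circ> D) ^^ m) (D T)"
  have iter: "(rough_laplacian I nb ^^ j) (tension I \<gamma> nb) t = (-1) ^ j *\<^sub>R ((D \<circ> D) ^^ j) (D T) t"
    if "t \<in> I" for j t
    using rough_laplacian_iterate[OF I DT, of "tension I \<gamma> nb"] tension_eq[OF I] that
    by (simp add: D_def T_def)
  \<comment> \<open>Subtracting the curvature term turns its sign \<open>(-1) ^ m\<close> into
    \<open>(-1) ^ Suc m\<close>, so all three terms share a nonzero factor, which drops out of the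
    equation.\<close>
  have "k_tension nab I \<gamma> nb k t =
      (-1) ^ Suc m *\<^sub>R (((D \<circ> D) ^^ Suc m) (D T) t + ?V t - (?V t \<bullet> T t) *\<^sub>R T t)" if t: "t \<in> I" for t
  proof -
    have V: "?V t \<in> tangent (\<gamma> t)" and Tt: "T t \<in> tangent (\<gamma> t)"
      using field_along_iterate[OF DT, of m] T t by (auto simp: field_along_def D_def)
    then have "(-1) ^ m *\<^sub>R ?V t \<in> tangent (\<gamma> t)" by (simp add: tangent_def)
    moreover have "\<gamma> t \<in> unit_sphere" using assms(7) t by blast
    moreover have vel: "velocity I \<gamma> t = T t" by (simp add: T_def)
    moreover have "T t \<bullet> T t = 1" using assms(8)[OF t] by (simp add: T_def dot_square_norm)
    \<comment> \<open>Arc length enters here: \<open>T t \<bullet> T t = 1\<close> turns the first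
      curvature summand into \<open>?V t\<close> itself, up to the sign
      \<open>(-1) ^ m\<close>.\<close>
    ultimately have "curvature_term nab I \<gamma> ((rough_laplacian I nb ^^ m) (tension I \<gamma> nb)) t
        = (-1) ^ m *\<^sub>R (?V t - (?V t \<bullet> T t) *\<^sub>R T t)"
      using curvature_eq[OF _ _ Tt Tt]
      by (simp add: curvature_term_def iter[OF t] differential_def e1_def vel scaleR_diff_right)
    then show ?thesis
      using iter[OF t, of "Suc m"] by (simp add: k_tension_def k algebra_simps)
  qed
  then show ?thesis
    unfolding k_harmonic_curve_def by (simp add: k)
qed

end
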